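(* Let $A\in\mathbb{C}^{n\times n}$, $b_1,\dots,b_s\in\mathbb{C}^n$ with $b_s\neq 0$, let $X\in\mathbb{C}^{ns\times s}$ be any full-rank matrix whose columns form a basis of $\mathcal K_s(J,\overline b)$, and let $W$, $K_X$, $M_X$, $R_X=M_X^{1/2}$ be as defined in the context. Then the metric field of values satisfies $$\mathcal F_{M_X}(K_X)=\mathcal F\bigl(R_XK_XR_X^{-1}\bigr).$$ Furthermore, $$\mathcal F_{M_X}(K_X)\subseteq\mathcal F(W).$$
   Context: For a square complex matrix $M$, $\mathcal F(M)=\{z^*Mz/(z^*z): z\ne0\}$ is the (Euclidean) field of values. For a square matrix $M$ and a vector $v$, $\mathcal K_m(M,v)=\operatorname{span}\{v,Mv,\dots,M^{m-1}v\}$. Let $n,s\ge1$. $J_s(0)$ is the $s\times s$ Jordan block with eigenvalue zero (ones on the first superdiagonal, zeros elsewhere). Set $J=J_s(0)\otimes I_n\in\mathbb{C}^{ns\times ns}$ (Kronecker product), $E=[I_n,0,\dots,0]\in\mathbb{C}^{n\times ns}$, $$W=\begin{bmatrix}A&E\\0&J\end{bmatrix}\in\mathbb{C}^{(s+1)n\times(s+1)n},\qquad \overline b=[b_1^*,\dots,b_s^*]^*\in\mathbb{C}^{ns}.$$ Since $b_s\ne0$, $\dim\mathcal K_s(J,\overline b)=s$ and this space is $J$-invariant. For $X\in\mathbb{C}^{ns\times s}$ with columns forming a basis of $\mathcal K_s(J,\overline b)$, let $N\in\mathbb{C}^{s\times s}$ be the unique matrix with $JX=XN$. Define $$K_X=\begin{bmatrix}A&EX\\0&N\end{bmatrix},\qquad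 Q_X=\begin{bmatrix}I_n&0\\0&X\end{bmatrix},\qquad M_X=Q_X^*Q_X=\begin{bmatrix}I_n&0\\0&X^*X\end{bmatrix}.$$ $M_X$ is Hermitian positive definite; $R_X=M_X^{1/2}$ is its principal (Hermitian positive definite) square root. With the inner product $\langle z,u\rangle_{M_X}=z^*M_Xu$ on $\mathbb{C}^{n+s}$, the metric field of values is $$\mathcal F_{M_X}(K_X)=\left\{\frac{\langle z,K_Xz\rangle_{M_X}}{\langle z,z\rangle_{M_X}}: z\in\mathbb{C}^{n+s},\ z\neq0\right\}.$$ *)

theory Defs
  imports
    "Jordan_Normal_Form.Jordan_Normal_Form"
    "Jordan_Normal_Form.Gauss_Jordan_Elimination"
    "Jordan_Normal_Form.Schur_Decomposition"
    "Jordan_Normal_Form.DL_Rank"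
begin

definition field_of_values :: "complex mat \<Rightarrow> complex set" where
  "field_of_values M =
     {(conjugate z \<bullet> (M *\<^sub>v z)) / (conjugate z \<bullet> z) | z.
        z \<in> carrier_vec (dim_row M) \<and> z \<noteq> 0\<^sub>v (dim_row M)}"

definition metric_inner :: "complex mat \<Rightarrow> complex vec \<Rightarrow> complex vec \<Rightarrow> complex" where
  "metric_inner M z u = conjugate z \<bullet> (M *\<^sub>v u)"

definition metric_field_of_values :: "complex mat \<Rightarrow> complex mat \<Rightarrow> complex set" where
  "metric_field_of_values M K =
     {metric_inner M z (K *\<^sub>v z) / metric_inner M z z | z.
        z \<in> carrier_vec (dim_row K) \<and> z \<noteq> 0\<^sub>v (dim_row K)}"

definition krylov_space :: "nat \<Rightarrow> complex mat \<Rightarrow> complex vec \<Rightarrow> complex vec set" where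
  "krylov_space m M v =
     LinearCombinations.module.span class_ring (module_vec TYPE(complex) (dim_vec v))
       {(M ^\<^sub>m k) *\<^sub>v v | k. k < m}"

text \<open>The record update equips the subset \<open>U\<close> of \<open>C^m\<close> with the inherited vector space structure,
  so that the library notion of a basis applies to it.  Distinctness is needed because
  \<open>set\<close> forgets repeated columns.\<close>
definition columns_form_basis :: "nat \<Rightarrow> complex vec set \<Rightarrow> complex mat \<Rightarrow> bool" where
  "columns_form_basis m U X \<longleftrightarrow>
     distinct (cols X) \<and>
     vectorspace.basis class_ring ((module_vec TYPE(complex) m)\<lparr>carrier := U\<rparr>) (set (cols X))"

definition kronecker :: "complex mat \<Rightarrow> complex mat \<Rightarrow> complex mat" where
  "kronecker A B =
     mat (dim_row A * dim_row B) (dim_col A * dim_col B)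
       (\<lambda>(i, j). A $$ (i div dim_row B, j div dim_col B) * B $$ (i mod dim_row B, j mod dim_col B))"

text \<open>Positivity is in the order on \<^typ>\<open>complex\<close>, where \<open>0 < c\<close> says that \<open>c\<close> is real and positive.\<close>
definition hermitian_pos_def :: "complex mat \<Rightarrow> bool" where
  "hermitian_pos_def M \<longleftrightarrow>
     square_mat M \<and> mat_adjoint M = M \<and>
     (\<forall>z \<in> carrier_vec (dim_row M). z \<noteq> 0\<^sub>v (dim_row M) \<longrightarrow> 0 < conjugate z \<bullet> (M *\<^sub>v z))"

definition principal_sqrt :: "complex mat \<Rightarrow> complex mat" where
  "principal_sqrt M =
     (THE R. R \<in> carrier_mat (dim_row M) (dim_row M) \<and> hermitian_pos_def R \<and> R * R = M)"

definition J_mat :: "nat \<Rightarrow> nat \<Rightarrow> complex mat" where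
  "J_mat n s = kronecker (jordan_block s 0) (1\<^sub>m n)"

definition E_mat :: "nat \<Rightarrow> nat \<Rightarrow> complex mat" where
  "E_mat n s = mat n (n * s) (\<lambda>(i, j). if i = j then 1 else 0)"

definition W_mat :: "nat \<Rightarrow> nat \<Rightarrow> complex mat \<Rightarrow> complex mat" where
  "W_mat n s A = four_block_mat A (E_mat n s) (0\<^sub>m (n * s) n) (J_mat n s)"

text \<open>The stacked vector with blocks \<open>b 1, \<dots>, b s\<close>, each of dimension \<open>n\<close>; entries are
  numbered from zero.\<close>
definition b_stack :: "nat \<Rightarrow> nat \<Rightarrow> (nat \<Rightarrow> complex vec) \<Rightarrow> complex vec" where
  "b_stack n s b = vec (n * s) (\<lambda>k. b (Suc (k div n)) $ (k mod n))"

text \<open>Existence and uniqueness in the next definition hold when the columns of \<open>X\<close> form a basis of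
  a \<open>J\<close>-invariant subspace, in particular of the Krylov space of \<open>b_stack n s b\<close>.\<close>
definition N_mat :: "nat \<Rightarrow> nat \<Rightarrow> complex mat \<Rightarrow> complex mat" where
  "N_mat n s X = (THE N. N \<in> carrier_mat s s \<and> J_mat n s * X = X * N)"

definition K_mat :: "nat \<Rightarrow> nat \<Rightarrow> complex mat \<Rightarrow> complex mat \<Rightarrow> complex mat" where
  "K_mat n s A X = four_block_mat A (E_mat n s * X) (0\<^sub>m s n) (N_mat n s X)"

definition Q_mat :: "nat \<Rightarrow> nat \<Rightarrow> complex mat \<Rightarrow> complex mat" where
  "Q_mat n s X = four_block_mat (1\<^sub>m n) (0\<^sub>m n s) (0\<^sub>m (n * s) n) X"

definition M_mat :: "nat \<Rightarrow> nat \<Rightarrow> complex mat \<Rightarrow> complex mat" where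
  "M_mat n s X = mat_adjoint (Q_mat n s X) * Q_mat n s X"

definition R_mat :: "nat \<Rightarrow> nat \<Rightarrow> complex mat \<Rightarrow> complex mat" where
  "R_mat n s X = principal_sqrt (M_mat n s X)"

text \<open>\<^const>\<open>mat_inverse\<close> returns an option, which is not \<^const>\<open>None\<close> for invertible matrices.\<close>
abbreviation matrix_inv :: "complex mat \<Rightarrow> complex mat" where
  "matrix_inv A \<equiv> the (mat_inverse A)"

end

(* Since J X = X N, the matrix Q intertwines K and W, that is Q K = W Q.  With M = Q* Q, the metric
   quotient of K at z is therefore the Euclidean quotient of W at Q z, and Q is injective.  With
   M = R R and R Hermitian, it is also the Euclidean quotient of R K R^-1 at R z.

   The principal square root comes from a diagonalization M = P D P^-1 in which P need not be
   unitary: M is Hermitian iff P* P commutes with D, and then P* P commutes with every function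
   of D, so P f(D) P^-1 is Hermitian for every real function f. *)
theory Submission
  imports
    Defs
    "Jordan_Normal_Form.Jordan_Normal_Form_Existence"
    "Jordan_Normal_Form.Jordan_Normal_Form_Uniqueness"
begin

section \<open>Adjoints\<close>

lemma mat_adjoint_alt:
  "mat_adjoint A = mat (dim_col A) (dim_row A) (\<lambda>(i, j). conjugate (A $$ (j, i)))"
  unfolding mat_adjoint_def by (rule eq_matI) (auto simp: mat_of_rows_def)

lemma mat_adjoint_carrier:
  "A \<in> carrier_mat m n \<Longrightarrow> mat_adjoint A \<in> carrier_mat n m"
  unfolding mat_adjoint_alt by auto

lemma mat_adjoint_adjoint: "mat_adjoint (mat_adjoint A) = A"
  unfolding mat_adjoint_alt by (rule eq_matI) auto

lemma mat_adjoint_mult: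
  fixes A B :: "complex mat"
  assumes "A \<in> carrier_mat m k" and "B \<in> carrier_mat k n"
  shows "mat_adjoint (A * B) = mat_adjoint B * mat_adjoint A"
  unfolding mat_adjoint_alt
  by (rule eq_matI) (use assms in \<open>auto simp: scalar_prod_def sum_conjugate conjugate_dist_mul
      mult.commute intro!: sum.cong\<close>)

lemma mat_adjoint_inner:
  fixes A :: "complex mat"
  assumes A: "A \<in> carrier_mat m n" and x: "x \<in> carrier_vec n" and y: "y \<in> carrier_vec m"
  shows "conjugate (A *\<^sub>v x) \<bullet> y = conjugate x \<bullet> (mat_adjoint A *\<^sub>v y)"
proof -
  let ?C = "mat_adjoint A"
  have C: "?C \<in> carrier_mat n m" using mat_adjoint_carrier[OF A] .
  \<comment> \<open>The entrywise conjugate of \<open>A\<close> is the transpose of its adjoint, and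
    a transpose can be moved across the bilinear scalar product.\<close>
  have "conjugate (A *\<^sub>v x) = transpose_mat ?C *\<^sub>v conjugate x"
    unfolding mat_adjoint_alt
    by (rule eq_vecI) (use A x in \<open>auto simp: scalar_prod_def sum_conjugate conjugate_dist_mul\<close>)
  then show ?thesis
    using transpose_vec_mult_scalar[OF C y] x by simp
qed

text \<open>Positivity is known for the product whose second factor is conjugated; commuting the
  factors gives the form used here.\<close>

lemma inner_self_pos:
  fixes v :: "complex vec"
  assumes "v \<in> carrier_vec n" and "v \<noteq> 0\<^sub>v n"
  shows "0 < conjugate v \<bullet> v"
  using conjugate_square_greater_0_vec[OF assms(1)] conjugate_vec_sprod_comm[OF assms(1,1)] assms(2)
  by simp

section \<open>Hermitian positive definite matrices\<close>

lemma hermitian_pos_defD: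
  assumes "hermitian_pos_def M" and "M \<in> carrier_mat n n"
  shows "mat_adjoint M = M"
    and "\<And>z. z \<in> carrier_vec n \<Longrightarrow> z \<noteq> 0\<^sub>v n \<Longrightarrow> 0 < conjugate z \<bullet> (M *\<^sub>v z)"
  using assms unfolding hermitian_pos_def_def by auto

text \<open>The form of \<open>mat_adjoint Q * Q\<close> at \<open>z\<close> is the squared norm of
  \<open>Q *\<^sub>v z\<close>. This serves both for the metric matrix and for the positivity of the
  square root.\<close>

lemma hermitian_pos_def_gram:
  fixes Q :: "complex mat"
  assumes Q: "Q \<in> carrier_mat m n"
    and inj: "\<And>z. z \<in> carrier_vec n \<Longrightarrow> Q *\<^sub>v z = 0\<^sub>v m \<Longrightarrow> z = 0\<^sub>v n"
  shows "hermitian_pos_def (mat_adjoint Q * Q)"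
proof -
  have Q': "mat_adjoint Q \<in> carrier_mat n m" using mat_adjoint_carrier[OF Q] .
  have "0 < conjugate z \<bullet> (mat_adjoint Q * Q *\<^sub>v z)" if z: "z \<in> carrier_vec n" "z \<noteq> 0\<^sub>v n" for z
  proof -
    have Qz: "Q *\<^sub>v z \<in> carrier_vec m" using Q z by auto
    have "conjugate z \<bullet> (mat_adjoint Q * Q *\<^sub>v z) = conjugate (Q *\<^sub>v z) \<bullet> (Q *\<^sub>v z)"
      using mat_adjoint_inner[OF Q z(1) Qz] assoc_mult_mat_vec[OF Q' Q z(1)] by simp
    then show ?thesis using inner_self_pos[OF Qz] inj[OF z(1)] z(2) by auto
  qed
  then show ?thesis
    unfolding hermitian_pos_def_def
    using Q Q' by (auto simp: mat_adjoint_mult[OF Q' Q] mat_adjoint_adjoint)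
qed

lemma hermitian_pos_def_kernel:
  assumes "hermitian_pos_def M" and "M \<in> carrier_mat n n"
    and "z \<in> carrier_vec n" and "M *\<^sub>v z = 0\<^sub>v n"
  shows "z = 0\<^sub>v n"
  using hermitian_pos_defD(2)[OF assms(1,2,3)] assms(3,4) by auto

text \<open>The form at \<open>z\<close> equals \<open>e\<close> times the squared norm of
  \<open>z\<close>, and both are positive. In the order on the complex numbers this also says that
  \<open>e\<close> is real.\<close>

lemma hermitian_pos_def_eigenvalue:
  assumes M: "hermitian_pos_def M" "M \<in> carrier_mat n n"
    and z: "z \<in> carrier_vec n" "z \<noteq> 0\<^sub>v n" and ev: "M *\<^sub>v z = e \<cdot>\<^sub>v z"
  shows "0 < e"
proof -
  have "conjugate z \<bullet> (M *\<^sub>v z) = e * (conjugate z \<bullet> z)"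
    using z unfolding ev by simp
  then have "0 < e * (conjugate z \<bullet> z)" using hermitian_pos_defD(2)[OF M z] by simp
  moreover have "0 < conjugate z \<bullet> z" using inner_self_pos[OF z] .
  ultimately show ?thesis
    by (auto simp: less_complex_def zero_less_mult_iff)
qed

text \<open>A trivial kernel makes the determinant nonzero, so \<open>mat_inverse\<close> returns a
  \<open>Some\<close>.\<close>

lemma hermitian_pos_def_inverse:
  assumes M: "hermitian_pos_def M" "M \<in> carrier_mat n n"
  shows "M * matrix_inv M = 1\<^sub>m n" and "matrix_inv M * M = 1\<^sub>m n"
    and "matrix_inv M \<in> carrier_mat n n"
proof -
  have "det M \<noteq> 0"
    using det_0_iff_vec_prod_zero_field[OF M(2)] hermitian_pos_def_kernel[OF M] by auto
  then have "M \<in> Units (ring_mat TYPE(complex) n ())"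
    by (rule det_non_zero_imp_unit[OF M(2)])
  then obtain B where "mat_inverse M = Some B"
    using mat_inverse(1)[OF M(2), where b = "()"] by (cases "mat_inverse M") auto
  then show "M * matrix_inv M = 1\<^sub>m n" "matrix_inv M * M = 1\<^sub>m n"
    "matrix_inv M \<in> carrier_mat n n"
    using mat_inverse(2)[OF M(2)] by auto
qed

section \<open>Diagonalization of positive definite matrices\<close>

lemma char_matrix_mult_vec:
  assumes "M \<in> carrier_mat n n" and "v \<in> carrier_vec n"
  shows "char_matrix M e *\<^sub>v v = M *\<^sub>v v - e \<cdot>\<^sub>v v"
  unfolding char_matrix_def
  by (rule eq_vecI) (use assms in \<open>auto simp: add_scalar_prod_distrib[of _ n]\<close>)

text \<open>A generalized eigenvector of a positive definite matrix is an eigenvector, because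
  \<open>M - e\<close> is self-adjoint as soon as \<open>e\<close> is an eigenvalue.\<close>
lemma hermitian_pos_def_gen_eigenvector:
  assumes M: "hermitian_pos_def M" "M \<in> carrier_mat n n"
    and v: "v \<in> carrier_vec n"
    and 0: "char_matrix M e *\<^sub>v (char_matrix M e *\<^sub>v v) = 0\<^sub>v n"
  shows "char_matrix M e *\<^sub>v v = 0\<^sub>v n"
proof (rule ccontr)
  let ?C = "char_matrix M e"
  let ?w = "?C *\<^sub>v v"
  assume w0: "?w \<noteq> 0\<^sub>v n"
  have C: "?C \<in> carrier_mat n n" using M(2) by simp
  have w: "?w \<in> carrier_vec n" using C v by auto
  have "M *\<^sub>v ?w - e \<cdot>\<^sub>v ?w = 0\<^sub>v n" using 0 char_matrix_mult_vec[OF M(2) w] by simp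
  then have "M *\<^sub>v ?w = e \<cdot>\<^sub>v ?w"
    using M(2) w by (auto simp: vec_eq_iff)
  \<comment> \<open>Positivity makes \<open>e\<close> real, which is what makes \<open>?C\<close>
    self-adjoint.\<close>
  then have e: "0 < e" using hermitian_pos_def_eigenvalue[OF M w w0] by blast
  have adj: "mat_adjoint M = M" using hermitian_pos_defD(1)[OF M] .
  have "cnj (M $$ (j, i)) = M $$ (i, j)" if "i < n" "j < n" for i j
    using arg_cong[OF adj, of "\<lambda>A. A $$ (i, j)"] that M(2) by (simp add: mat_adjoint_alt)
  moreover have "cnj e = e" using e by (auto simp: less_complex_def complex_eq_iff)
  ultimately have "mat_adjoint ?C = ?C"
    using M(2) unfolding mat_adjoint_alt char_matrix_def by (intro eq_matI) auto
  \<comment> \<open>The squared norm of \<open>?w\<close> is the product of \<open>v\<close> with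
    \<open>?C *\<^sub>v ?w\<close>, which vanishes.\<close>
  then have "conjugate ?w \<bullet> ?w = conjugate v \<bullet> (?C *\<^sub>v ?w)"
    using mat_adjoint_inner[OF C v w] by simp
  then show False using inner_self_pos[OF w w0] 0 v by simp
qed

lemma jordan_matrix_diagonal:
  assumes "\<And>k a. (k, a) \<in> set n_as \<Longrightarrow> k = 1"
  shows "diagonal_mat (jordan_matrix n_as :: complex mat)"
  using assms
proof (induction n_as)
  case Nil
  then show ?case by (simp add: jordan_matrix_def diagonal_mat_def)
next
  case (Cons na n_as)
  obtain a where na: "na = (1, a)" using Cons.prems by (cases na) auto
  have IH: "diagonal_mat (jordan_matrix n_as)" using Cons by auto
  show ?case
    using IH unfolding na jordan_matrix_Cons diagonal_mat_def by (auto simp: less_Suc_eq_0_disj) blast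
qed

text \<open>This lets a single large Jordan block show up as strict growth of a generalized
  eigenspace.\<close>

lemma sum_list_strict_mono_one:
  fixes f g :: "'a \<Rightarrow> nat"
  assumes "\<And>x. x \<in> set xs \<Longrightarrow> f x \<le> g x" and "y \<in> set xs" and "f y < g y"
  shows "sum_list (map f xs) < sum_list (map g xs)"
  using assms
proof (induction xs)
  case (Cons x xs)
  have "sum_list (map f xs) \<le> sum_list (map g xs)" using Cons.prems by (intro sum_list_mono) auto
  then show ?case using Cons by (auto intro: add_less_le_mono add_le_less_mono)
qed auto

text \<open>All Jordan blocks have size one: a larger block for \<open>e\<close> would make the
  kernel of \<open>(M - e)^2\<close> strictly larger than that of \<open>M - e\<close>. The
  similarity is not claimed to be unitary.\<close>

lemma hermitian_pos_def_diagonalization: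
  assumes M: "hermitian_pos_def M" "M \<in> carrier_mat n n"
  obtains P Q d where "P \<in> carrier_mat n n" "Q \<in> carrier_mat n n" "P * Q = 1\<^sub>m n" "Q * P = 1\<^sub>m n"
    "M = P * mat_diag n (\<lambda>i. complex_of_real (d i)) * Q" "\<And>i. i < n \<Longrightarrow> 0 < d i"
proof -
  obtain as where "char_poly M = (\<Prod>a\<leftarrow>as. [:- a, 1:])"
    using char_poly_factorized[OF M(2)] by blast
  then obtain n_as where jnf: "jordan_nf M n_as" using jordan_nf_exists[OF M(2)] by blast
  let ?J = "jordan_matrix n_as"
  have size: "k = 1" if mem: "(k, e) \<in> set n_as" for k e
  proof (rule ccontr)
    assume "k \<noteq> 1"
    moreover have "k \<noteq> 0" using jnf mem unfolding jordan_nf_def by force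
    ultimately have k: "2 \<le> k" by simp
    let ?C = "char_matrix M e"
    have C: "?C \<in> carrier_mat n n" using M(2) by simp
    have "mat_kernel (?C * ?C) = mat_kernel ?C"
      using C hermitian_pos_def_gen_eigenvector[OF M, of _ e]
      by (auto simp: mat_kernel_def)
    then have "dim_gen_eigenspace M e 2 = dim_gen_eigenspace M e 1"
      using C unfolding dim_gen_eigenspace_def kernel_dim_def
      by (simp add: numeral_2_eq_2)
    \<comment> \<open>A block of size \<open>k\<close> for \<open>e\<close> contributes
      \<open>min i k\<close> to the dimension at exponent \<open>i\<close>, here 1 against
      2.\<close>
    moreover have "dim_gen_eigenspace M e 1 < dim_gen_eigenspace M e 2"
      unfolding dim_gen_eigenspace[OF jnf]
      by (rule sum_list_strict_mono_one[where y = k]) (use mem k in \<open>force+\<close>)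
    ultimately show False by simp
  qed
  obtain P Q where "similar_mat_wit M ?J P Q"
    using jnf unfolding jordan_nf_def similar_mat_def by blast
  note wit = similar_mat_witD2[OF M(2) this]
  define D where "D = (\<lambda>i. ?J $$ (i, i))"
  have J: "?J = mat_diag n D"
    using wit(5) jordan_matrix_diagonal[of n_as] size
    unfolding mat_diag_def D_def diagonal_mat_def by (intro eq_matI) auto
  have pos: "0 < D i" if i: "i < n" for i
  proof (rule hermitian_pos_def_eigenvalue[OF M])
    \<comment> \<open>Read by columns, \<open>M * P = P * D\<close> says that column
      \<open>i\<close> of \<open>P\<close> is an eigenvector for \<open>D i\<close>.\<close>
    have "M * P = P * ?J * (Q * P)" using wit by (simp add: assoc_mult_mat[of _ n n _ n _ n])
    then have MP: "M * P = P * mat_diag n D"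
      using wit J by (simp add: mult_carrier_mat[of _ n n _ n] right_mult_one_mat[of _ n n])
    show "col P i \<in> carrier_vec n" using wit i by auto
    show "M *\<^sub>v col P i = D i \<cdot>\<^sub>v col P i"
    proof -
      have "M *\<^sub>v col P i = col (M * P) i" using wit i by (intro eq_vecI) auto
      also have "\<dots> = D i \<cdot>\<^sub>v col P i"
        unfolding MP using wit(6) i by (intro eq_vecI) (auto simp: mat_diag_mult_right[OF wit(6)])
      finally show ?thesis .
    qed
    have "Q *\<^sub>v col P i = unit_vec n i"
      using col_mult2[OF wit(7,6) i] i unfolding wit(2) by simp
    moreover have "Q *\<^sub>v 0\<^sub>v n = 0\<^sub>v n" using wit(7) by auto
    ultimately show "col P i \<noteq> 0\<^sub>v n" using unit_vec_nonzero[OF i] by metis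
  qed
  have "?J = mat_diag n (\<lambda>i. complex_of_real (Re (D i)))"
    unfolding J mat_diag_def using pos
    by (intro eq_matI) (auto simp: less_complex_def complex_eq_iff)
  moreover have "\<And>i. i < n \<Longrightarrow> 0 < Re (D i)" using pos by (simp add: less_complex_def)
  ultimately show ?thesis
    using that[OF wit(6,7,1,2), of "\<lambda>i. Re (D i)"] wit(3) by metis
qed

section \<open>The principal square root\<close>

lemma mat_adjoint_one: "mat_adjoint (1\<^sub>m n :: complex mat) = 1\<^sub>m n"
  unfolding mat_adjoint_alt by (rule eq_matI) auto

lemma mat_adjoint_mat_diag_real:
  "mat_adjoint (mat_diag n (\<lambda>i. complex_of_real (f i))) = mat_diag n (\<lambda>i. complex_of_real (f i))"
  unfolding mat_adjoint_alt mat_diag_def by (rule eq_matI) auto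

text \<open>The hypothesis says \<open>(S + r) (S - r) w = 0\<close>. As \<open>-r\<close> is
  negative it is no eigenvalue of \<open>S\<close>, so \<open>(S - r) w\<close> is zero.\<close>

lemma hermitian_pos_def_sqrt_eigenvector:
  assumes S: "hermitian_pos_def S" "S \<in> carrier_mat n n"
    and w: "w \<in> carrier_vec n" and r: "0 < r"
    and ev: "(S * S) *\<^sub>v w = complex_of_real (r * r) \<cdot>\<^sub>v w"
  shows "S *\<^sub>v w = complex_of_real r \<cdot>\<^sub>v w"
proof -
  let ?r = "complex_of_real r"
  define u where "u = S *\<^sub>v w - ?r \<cdot>\<^sub>v w"
  have Sw: "S *\<^sub>v w \<in> carrier_vec n" using S(2) w by auto
  have u: "u \<in> carrier_vec n" unfolding u_def using Sw w by auto
  have "S *\<^sub>v u = (S * S) *\<^sub>v w - ?r \<cdot>\<^sub>v (S *\<^sub>v w)"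
    unfolding u_def using S(2) w Sw
    by (simp add: mult_minus_distrib_mat_vec[of _ n n] mult_mat_vec[of _ n n]
        assoc_mult_mat_vec[of _ n n _ n])
  also have "\<dots> = (- ?r) \<cdot>\<^sub>v u"
    unfolding ev u_def using w Sw S(2) by (intro eq_vecI) (auto simp: algebra_simps)
  finally have "u = 0\<^sub>v n"
    using hermitian_pos_def_eigenvalue[OF S u, of "- ?r"] r by (auto simp: less_complex_def)
  then show ?thesis
    using Sw w S(2) unfolding u_def by (auto simp: vec_eq_iff)
qed

text \<open>Existence applies \<open>sqrt\<close> to the eigenvalues. For uniqueness, any root acts
  on each column of \<open>P\<close> as multiplication by \<open>sqrt (d i)\<close>, and these
  columns form a basis.\<close>

lemma ex1_hermitian_pos_def_sqrt:
  assumes M: "hermitian_pos_def M" "M \<in> carrier_mat n n"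
  shows "\<exists>!R. R \<in> carrier_mat n n \<and> hermitian_pos_def R \<and> R * R = M"
proof -
  obtain P Q d where P: "P \<in> carrier_mat n n" and Q: "Q \<in> carrier_mat n n"
    and PQ: "P * Q = 1\<^sub>m n" and QP: "Q * P = 1\<^sub>m n"
    and MPQ: "M = P * mat_diag n (\<lambda>i. complex_of_real (d i)) * Q"
    and d: "\<And>i. i < n \<Longrightarrow> 0 < d i"
    using hermitian_pos_def_diagonalization[OF M] by blast
  \<comment> \<open>A functional calculus: \<open>D f\<close> applies \<open>f\<close> to the
    eigenvalues, and \<open>F f\<close> plays the role of \<open>f(M)\<close>.\<close>
  define D where "D f = mat_diag n (\<lambda>i. complex_of_real (f (d i)))" for f :: "real \<Rightarrow> real"
  define F where "F f = P * D f * Q" for f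
  have D: "D f \<in> carrier_mat n n" for f unfolding D_def by simp
  have F: "F f \<in> carrier_mat n n" for f unfolding F_def using P Q D by auto
  note assoc = assoc_mult_mat[of _ n n _ n _ n] mult_carrier_mat[of _ n n _ n]
    right_mult_one_mat[of _ n n]
  have cancel: "Q * (P * Z) = Z" "P * (Q * Z) = Z" if "Z \<in> carrier_mat n n" for Z
    using that P Q PQ QP by (metis assoc left_mult_one_mat)+
  have DD: "D f * D g = D (\<lambda>x. f x * g x)" for f g unfolding D_def by simp
  have DD': "D f * (D g * Z) = D (\<lambda>x. f x * g x) * Z" if "Z \<in> carrier_mat n n" for f g Z
    using DD D that by (metis assoc)
  have FF: "F f * F g = F (\<lambda>x. f x * g x)" for f g
    unfolding F_def using P Q D by (simp add: assoc cancel DD')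
  have F_cong: "F f = F g" if "\<And>i. i < n \<Longrightarrow> f (d i) = g (d i)" for f g
    unfolding F_def D_def mat_diag_def
    by (intro arg_cong[where f = "\<lambda>A. P * A * Q"] eq_matI) (use that in auto)
  have M_F: "M = F (\<lambda>x. x)" unfolding F_def D_def MPQ ..
  define P' where "P' = mat_adjoint P"
  define Q' where "Q' = mat_adjoint Q"
  have P': "P' \<in> carrier_mat n n" and Q': "Q' \<in> carrier_mat n n"
    unfolding P'_def Q'_def using P Q mat_adjoint_carrier by auto
  have "P' * Q' = 1\<^sub>m n" "Q' * P' = 1\<^sub>m n"
    unfolding P'_def Q'_def using mat_adjoint_mult[OF P Q] mat_adjoint_mult[OF Q P] PQ QP
    by (metis mat_adjoint_one)+
  then have cancel': "Q' * (P' * Z) = Z" "P' * (Q' * Z) = Z" if "Z \<in> carrier_mat n n" for Z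
    using that P' Q' by (metis assoc left_mult_one_mat)+
  have adj_F: "mat_adjoint (F f) = Q' * (D f * P')" for f
    unfolding F_def P'_def Q'_def using P Q D mat_adjoint_carrier[OF P]
    by (simp add: mat_adjoint_mult[of _ n n _ n] D_def mat_adjoint_mat_diag_real)
  \<comment> \<open>This is self-adjointness of \<open>M\<close> in terms of the factors.
    Multiplying by \<open>P'\<close> on the left and by \<open>P\<close> on the right turns it into
    commutation of \<open>P' * P\<close> with the eigenvalue matrix.\<close>
  have "Q' * (D (\<lambda>x. x) * P') = P * D (\<lambda>x. x) * Q"
    using hermitian_pos_defD(1)[OF M] adj_F M_F unfolding F_def by metis
  then have "P' * (Q' * (D (\<lambda>x. x) * P')) * P = P' * (P * D (\<lambda>x. x) * Q) * P" by simp
  then have comm_id: "D (\<lambda>x. x) * (P' * P) = (P' * P) * D (\<lambda>x. x)"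
    using P Q P' Q' D by (simp add: assoc cancel cancel' QP)
  \<comment> \<open>Hence \<open>P' * P\<close> is supported on the pairs \<open>(i, j)\<close> with \<open>d i = d j\<close>.\<close>
  have comm: "D f * (P' * P) = (P' * P) * D f" for f
  proof -
    have G: "P' * P \<in> carrier_mat n n" using P P' by simp
    have "d i = d j \<or> (P' * P) $$ (i, j) = 0" if ij: "i < n" "j < n" for i j
      using arg_cong[OF comm_id, of "\<lambda>A. A $$ (i, j)"] ij
      unfolding D_def mat_diag_mult_left[OF G] mat_diag_mult_right[OF G] by (auto simp del: index_mult_mat)
    then show ?thesis
      unfolding D_def mat_diag_mult_left[OF G] mat_diag_mult_right[OF G]
      by (intro eq_matI) (force simp del: index_mult_mat)+
  qed
  have herm: "mat_adjoint (F f) = F f" for f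
  proof -
    \<comment> \<open>Inserting \<open>P * Q = 1\<close> produces the factor \<open>P' * P\<close>,
      which can then be moved past \<open>D f\<close>.\<close>
    have "Q' * (D f * P') = Q' * (D f * (P' * P)) * Q"
      using P Q P' Q' D PQ by (simp add: assoc)
    also have "\<dots> = F f"
      unfolding comm F_def using P Q P' Q' D by (simp add: assoc cancel')
    finally show ?thesis unfolding adj_F .
  qed
  define R where "R = F sqrt"
  \<comment> \<open>The fourth root of \<open>M\<close> exhibits \<open>R\<close> as a Gram matrix,
    so that its positivity reduces to injectivity of \<open>V\<close>.\<close>
  define V where "V = F (\<lambda>x. sqrt (sqrt x))"
  have RR: "R * R = M"
    unfolding R_def FF M_F by (rule F_cong) (use d in \<open>auto simp: less_imp_le\<close>)
  have VV: "mat_adjoint V * V = R"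
    unfolding V_def herm FF R_def by (rule F_cong) (use d in \<open>auto simp: less_imp_le\<close>)
  have R: "R \<in> carrier_mat n n" and V: "V \<in> carrier_mat n n"
    unfolding R_def V_def using F by auto
  have "hermitian_pos_def R"
    unfolding VV[symmetric]
  proof (rule hermitian_pos_def_gram[OF V])
    fix z assume z: "z \<in> carrier_vec n" and Vz: "V *\<^sub>v z = 0\<^sub>v n"
    \<comment> \<open>The kernel of \<open>V\<close> lies in that of \<open>R\<close>, hence in that
      of \<open>M\<close>, which is trivial.\<close>
    have "R *\<^sub>v z = mat_adjoint V *\<^sub>v (V *\<^sub>v z)"
      unfolding VV[symmetric] using V mat_adjoint_carrier[OF V] z by simp
    moreover have "mat_adjoint V *\<^sub>v 0\<^sub>v n = 0\<^sub>v n" using mat_adjoint_carrier[OF V] by auto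
    ultimately have "R *\<^sub>v z = 0\<^sub>v n" unfolding Vz by simp
    moreover have "R *\<^sub>v 0\<^sub>v n = 0\<^sub>v n" using R by auto
    ultimately have "M *\<^sub>v z = 0\<^sub>v n"
      unfolding RR[symmetric] using R z by simp
    then show "z = 0\<^sub>v n" by (rule hermitian_pos_def_kernel[OF M z])
  qed
  moreover have "S = R" if S: "S \<in> carrier_mat n n" "hermitian_pos_def S" "S * S = M" for S
  proof -
    \<comment> \<open>Compared column by column, since the columns of \<open>P\<close> are
      eigenvectors of \<open>M = S * S\<close>.\<close>
    have "S * P = P * D sqrt"
    proof (rule mat_col_eqI)
      fix i assume "i < dim_col (P * D sqrt)"
      then have i: "i < n" using D[of sqrt] by simp
      have w: "col P i \<in> carrier_vec n" using P i by auto
      have "M * P = P * D (\<lambda>x. x)"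
        unfolding M_F F_def using P Q D QP by (simp add: assoc)
      then have "M *\<^sub>v col P i = col (P * D (\<lambda>x. x)) i"
        using col_mult2[OF M(2) P i] by simp
      also have "\<dots> = complex_of_real (sqrt (d i) * sqrt (d i)) \<cdot>\<^sub>v col P i"
        unfolding D_def mat_diag_mult_right[OF P] using P i d[OF i]
        by (intro eq_vecI) (auto simp: less_imp_le)
      finally have "S *\<^sub>v col P i = complex_of_real (sqrt (d i)) \<cdot>\<^sub>v col P i"
        using d[OF i] unfolding S(3)[symmetric]
        by (intro hermitian_pos_def_sqrt_eigenvector[OF S(2,1) w]) auto
      also have "\<dots> = col (P * D sqrt) i"
        unfolding D_def mat_diag_mult_right[OF P] using P i by (intro eq_vecI) auto
      finally show "col (S * P) i = col (P * D sqrt) i"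
        using col_mult2[OF S(1) P i] by simp
    qed (use S P D[of sqrt] in auto)
    then have "S * P * Q = R" unfolding R_def F_def by simp
    then show ?thesis using S(1) P Q PQ by (simp add: assoc)
  qed
  ultimately show ?thesis using R RR by blast
qed

lemma principal_sqrt:
  assumes M: "hermitian_pos_def M" "M \<in> carrier_mat n n"
  shows "principal_sqrt M \<in> carrier_mat n n" and "hermitian_pos_def (principal_sqrt M)"
    and "principal_sqrt M * principal_sqrt M = M"
  using theI'[OF ex1_hermitian_pos_def_sqrt[OF M]] M(2) unfolding principal_sqrt_def by auto

section \<open>Metric fields of values\<close>

text \<open>The substitution \<open>w = R z\<close> turns one quotient into the other, and it is a
  bijection on nonzero vectors.\<close>

lemma metric_field_of_values_conv_sqrt:
  assumes R: "hermitian_pos_def R" "R \<in> carrier_mat n n" and K: "K \<in> carrier_mat n n"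
  shows "metric_field_of_values (R * R) K = field_of_values (R * K * matrix_inv R)"
proof -
  let ?S = "matrix_inv R"
  note inv = hermitian_pos_def_inverse[OF R]
  note assoc = assoc_mult_mat_vec[of _ n n _ n]
  have metric: "metric_inner (R * R) z u = conjugate (R *\<^sub>v z) \<bullet> (R *\<^sub>v u)"
    if "z \<in> carrier_vec n" "u \<in> carrier_vec n" for z u
    unfolding metric_inner_def
    using mat_adjoint_inner[OF R(2) that(1), of "R *\<^sub>v u"] hermitian_pos_defD(1)[OF R] R(2) that
    by (simp add: assoc)
  have SR: "?S *\<^sub>v (R *\<^sub>v z) = z" and RS: "R *\<^sub>v (?S *\<^sub>v z) = z" if "z \<in> carrier_vec n" for z
    using that inv R(2) by (metis assoc one_mult_mat_vec)+
  have quot: "metric_inner (R * R) z (K *\<^sub>v z) / metric_inner (R * R) z z =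
      conjugate (R *\<^sub>v z) \<bullet> (R * K * ?S *\<^sub>v (R *\<^sub>v z)) / (conjugate (R *\<^sub>v z) \<bullet> (R *\<^sub>v z))"
    if z: "z \<in> carrier_vec n" for z
    using z R(2) K inv(3) by (simp add: metric assoc SR)
  have nz: "R *\<^sub>v z = 0\<^sub>v n \<longleftrightarrow> z = 0\<^sub>v n" if "z \<in> carrier_vec n" for z
    using hermitian_pos_def_kernel[OF R that] R(2) by auto
  show ?thesis
  proof (intro equalityI subsetI)
    fix x assume "x \<in> metric_field_of_values (R * R) K"
    then obtain z where z: "z \<in> carrier_vec n" "z \<noteq> 0\<^sub>v n"
      and x: "x = metric_inner (R * R) z (K *\<^sub>v z) / metric_inner (R * R) z z"
      unfolding metric_field_of_values_def using K by auto
    have "R *\<^sub>v z \<in> carrier_vec n" "R *\<^sub>v z \<noteq> 0\<^sub>v n" using z R(2) nz by auto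
    then show "x \<in> field_of_values (R * K * ?S)"
      unfolding field_of_values_def x quot[OF z(1)] using R(2) by auto
  next
    fix x assume "x \<in> field_of_values (R * K * ?S)"
    then obtain w where w: "w \<in> carrier_vec n" "w \<noteq> 0\<^sub>v n"
      and x: "x = conjugate w \<bullet> (R * K * ?S *\<^sub>v w) / (conjugate w \<bullet> w)"
      unfolding field_of_values_def using R(2) by auto
    define z where "z = ?S *\<^sub>v w"
    have z: "z \<in> carrier_vec n" and Rz: "R *\<^sub>v z = w" unfolding z_def using w RS inv(3) by auto
    then have "z \<noteq> 0\<^sub>v n" using nz w by auto
    then show "x \<in> metric_field_of_values (R * R) K"
      unfolding metric_field_of_values_def x
      using quot[OF z, unfolded Rz, symmetric] K z by auto
  qed
qed

text \<open>The quotient of \<open>K\<close> at \<open>z\<close> is that of \<open>W\<close> at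
  \<open>Q z\<close>. Only vectors in the range of \<open>Q\<close> arise, whence an
  inclusion.\<close>

lemma metric_field_of_values_gram_subset:
  assumes Q: "Q \<in> carrier_mat m n" and K: "K \<in> carrier_mat n n" and W: "W \<in> carrier_mat m m"
    and inj: "\<And>z. z \<in> carrier_vec n \<Longrightarrow> Q *\<^sub>v z = 0\<^sub>v m \<Longrightarrow> z = 0\<^sub>v n"
    and QK: "Q * K = W * Q"
  shows "metric_field_of_values (mat_adjoint Q * Q) K \<subseteq> field_of_values W"
proof
  fix x assume "x \<in> metric_field_of_values (mat_adjoint Q * Q) K"
  then obtain z where z: "z \<in> carrier_vec n" "z \<noteq> 0\<^sub>v n"
    and x: "x = metric_inner (mat_adjoint Q * Q) z (K *\<^sub>v z) / metric_inner (mat_adjoint Q * Q) z z"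
    unfolding metric_field_of_values_def using K by auto
  have metric: "metric_inner (mat_adjoint Q * Q) z u = conjugate (Q *\<^sub>v z) \<bullet> (Q *\<^sub>v u)"
    if u: "u \<in> carrier_vec n" for u
    unfolding metric_inner_def
    using mat_adjoint_inner[OF Q z(1), of "Q *\<^sub>v u"] Q u
      assoc_mult_mat_vec[OF mat_adjoint_carrier[OF Q] Q u] by simp
  have "Q *\<^sub>v (K *\<^sub>v z) = W *\<^sub>v (Q *\<^sub>v z)"
    using QK assoc_mult_mat_vec[OF Q K z(1)] assoc_mult_mat_vec[OF W Q z(1)] by simp
  then have "x = conjugate (Q *\<^sub>v z) \<bullet> (W *\<^sub>v (Q *\<^sub>v z)) / (conjugate (Q *\<^sub>v z) \<bullet> (Q *\<^sub>v z))"
    unfolding x using metric z K by simp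
  moreover have "Q *\<^sub>v z \<in> carrier_vec m" "Q *\<^sub>v z \<noteq> 0\<^sub>v m" using Q z inj by auto
  ultimately show "x \<in> field_of_values W"
    unfolding field_of_values_def using W by auto
qed

section \<open>Krylov spaces of the block shift\<close>

lemma J_mat_carrier: "J_mat n s \<in> carrier_mat (n * s) (n * s)"
  unfolding J_mat_def kronecker_def by (simp add: mult.commute)

text \<open>An index \<open>i\<close> splits into the block number \<open>i div n\<close> and the
  offset \<open>i mod n\<close>. Going to the next block at the same offset means adding
  \<open>n\<close>.\<close>

lemma J_mat_index:
  assumes "i < n * s" and "j < n * s"
  shows "J_mat n s $$ (i, j) = (if j = i + n then 1 else 0)"
proof -
  have n: "0 < n" using assms by (cases n) auto
  have "i div n < s" "j div n < s"
    using assms by (simp_all add: less_mult_imp_div_less mult.commute)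
  moreover have "Suc (i div n) = j div n \<and> i mod n = j mod n \<longleftrightarrow> j = i + n"
  proof
    assume *: "Suc (i div n) = j div n \<and> i mod n = j mod n"
    have "j = n * (j div n) + j mod n" by simp
    also have "\<dots> = n * Suc (i div n) + i mod n" using * by simp
    also have "\<dots> = i + n" by simp
    finally show "j = i + n" .
  qed (use n in simp)
  ultimately show ?thesis
    using assms n unfolding J_mat_def kronecker_def by (auto simp: mult.commute)
qed

lemma J_mat_mult_vec_index:
  assumes v: "v \<in> carrier_vec (n * s)" and i: "i < n * s"
  shows "(J_mat n s *\<^sub>v v) $ i = (if i + n < n * s then v $ (i + n) else 0)"
proof -
  have "(J_mat n s *\<^sub>v v) $ i = (\<Sum>j = 0..<n * s. J_mat n s $$ (i, j) * v $ j)"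
    using J_mat_carrier[of n s] v i by (auto simp: scalar_prod_def)
  also have "\<dots> = (\<Sum>j = 0..<n * s. if j = i + n then v $ j else 0)"
    using i by (intro sum.cong) (auto simp: J_mat_index)
  finally show ?thesis by simp
qed

lemma J_mat_pow_mult_vec_index:
  assumes v: "v \<in> carrier_vec (n * s)" and i: "i < n * s"
  shows "(J_mat n s ^\<^sub>m k *\<^sub>v v) $ i = (if i + k * n < n * s then v $ (i + k * n) else 0)"
  using v
proof (induction k arbitrary: v)
  case 0
  then show ?case using J_mat_carrier[of n s] i by simp
next
  case (Suc k)
  note J = J_mat_carrier[of n s]
  have Jv: "J_mat n s *\<^sub>v v \<in> carrier_vec (n * s)" using J Suc.prems by auto
  \<comment> \<open>Matrix powers grow by a factor on the right, so the induction hypothesis is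
    applied to \<open>J_mat n s *\<^sub>v v\<close>; hence \<open>v\<close> is arbitrary.\<close>
  have "J_mat n s ^\<^sub>m Suc k *\<^sub>v v = J_mat n s ^\<^sub>m k *\<^sub>v (J_mat n s *\<^sub>v v)"
    using J Suc.prems by (simp add: assoc_mult_mat_vec[of _ "n * s" "n * s" _ "n * s"])
  then show ?case
    using Suc.IH[OF Jv] Suc.prems i by (auto simp: J_mat_mult_vec_index algebra_simps)
qed

text \<open>The recursion of powers puts the new factor on the right; that it may stand on the left
  is read off from the shift formulas.\<close>

lemma J_mat_mult_pow:
  assumes v: "v \<in> carrier_vec (n * s)"
  shows "J_mat n s *\<^sub>v (J_mat n s ^\<^sub>m k *\<^sub>v v) = J_mat n s ^\<^sub>m Suc k *\<^sub>v v"
proof (rule eq_vecI)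
  note J = J_mat_carrier[of n s]
  fix i assume "i < dim_vec (J_mat n s ^\<^sub>m Suc k *\<^sub>v v)"
  then have i: "i < n * s" using J by simp
  have "J_mat n s ^\<^sub>m k *\<^sub>v v \<in> carrier_vec (n * s)"
    using mult_mat_vec_carrier[OF pow_carrier_mat[OF J] v] .
  then show "(J_mat n s *\<^sub>v (J_mat n s ^\<^sub>m k *\<^sub>v v)) $ i = (J_mat n s ^\<^sub>m Suc k *\<^sub>v v) $ i"
    using v i by (auto simp del: pow_mat.simps
        simp: J_mat_mult_vec_index J_mat_pow_mult_vec_index algebra_simps)
qed (use J_mat_carrier[of n s] in simp)

text \<open>A shift by \<open>s * n\<close> positions pushes every entry out of range.\<close>

lemma J_mat_nilpotent:
  assumes v: "v \<in> carrier_vec (n * s)"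
  shows "J_mat n s ^\<^sub>m s *\<^sub>v v = 0\<^sub>v (n * s)"
  by (rule eq_vecI)
    (use J_mat_carrier[of n s] in \<open>auto simp: J_mat_pow_mult_vec_index[OF v] mult.commute
      simp del: index_mult_mat_vec\<close>)

text \<open>The span is the column space of the matrix of Krylov vectors, so membership becomes a
  matrix equation.\<close>

lemma krylov_space_conv_mat:
  fixes s :: nat
  assumes v: "v \<in> carrier_vec m" and M: "M \<in> carrier_mat m m"
  defines "Y \<equiv> mat_of_cols m (map (\<lambda>k. M ^\<^sub>m k *\<^sub>v v) [0..<s])"
  shows "krylov_space s M v = {Y *\<^sub>v x | x. x \<in> carrier_vec s}"
proof -
  interpret vec_space "TYPE(complex)" m .
  have Y: "Y \<in> carrier_mat m s" unfolding Y_def by (rule carrier_matI) simp_all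
  have "set (map (\<lambda>k. M ^\<^sub>m k *\<^sub>v v) [0..<s]) \<subseteq> carrier_vec m"
    using mult_mat_vec_carrier[OF pow_carrier_mat[OF M] v] by auto
  then have "set (cols Y) = {M ^\<^sub>m k *\<^sub>v v | k. k < s}"
    unfolding Y_def by (subst cols_mat_of_cols) auto
  then have "krylov_space s M v = col_space Y"
    using v unfolding krylov_space_def col_space_def by simp
  also have "\<dots> = {Y *\<^sub>v x | x. x \<in> carrier_vec s}"
    unfolding col_space_eq[OF Y] using Y by auto
  finally show ?thesis .
qed

text \<open>\<open>J_mat n s\<close> sends each Krylov vector to the next one and kills the last by
  nilpotency.\<close>

lemma krylov_space_J_mat_invariant:
  assumes v: "v \<in> carrier_vec (n * s)" and u: "u \<in> krylov_space s (J_mat n s) v"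
  shows "J_mat n s *\<^sub>v u \<in> krylov_space s (J_mat n s) v"
proof -
  let ?J = "J_mat n s"
  define Y where "Y = mat_of_cols (n * s) (map (\<lambda>k. ?J ^\<^sub>m k *\<^sub>v v) [0..<s])"
  \<comment> \<open>Ones on the subdiagonal: column \<open>k\<close> selects Krylov vector
    \<open>k + 1\<close>, and the last column is zero.\<close>
  define N :: "complex mat" where "N = mat s s (\<lambda>(i, j). if i = Suc j then 1 else 0)"
  note J = J_mat_carrier[of n s]
  note krylov = krylov_space_conv_mat[OF v J, of s, folded Y_def]
  have Y: "Y \<in> carrier_mat (n * s) s" and N: "N \<in> carrier_mat s s"
    unfolding Y_def N_def by auto
  have col_Y: "col Y k = ?J ^\<^sub>m k *\<^sub>v v" if "k < s" for k
    using that mult_mat_vec_carrier[OF pow_carrier_mat[OF J] v] unfolding Y_def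
    by (subst col_mat_of_cols) auto
  have "?J * Y = Y * N"
  proof (rule mat_col_eqI)
    fix k assume "k < dim_col (Y * N)"
    then have k: "k < s" using N by simp
    have "col (?J * Y) k = ?J ^\<^sub>m Suc k *\<^sub>v v"
      using col_mult2[OF J Y k] J_mat_mult_pow[OF v] col_Y[OF k] by simp
    moreover have "col (Y * N) k = (if Suc k < s then col Y (Suc k) else 0\<^sub>v (n * s))"
    proof (rule eq_vecI)
      fix i assume "i < dim_vec (if Suc k < s then col Y (Suc k) else 0\<^sub>v (n * s))"
      then have i: "i < n * s" using Y by (simp split: if_splits)
      have "col (Y * N) k $ i = (\<Sum>j = 0..<s. Y $$ (i, j) * (if j = Suc k then 1 else 0))"
        using Y i k unfolding N_def by (simp add: scalar_prod_def)
      also have "\<dots> = (if Suc k < s then Y $$ (i, Suc k) else 0)"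
        by (simp add: if_distrib[of "(*) _"] cong: if_cong)
      also have "\<dots> = (if Suc k < s then col Y (Suc k) else 0\<^sub>v (n * s)) $ i"
        using Y i by simp
      finally show "col (Y * N) k $ i = (if Suc k < s then col Y (Suc k) else 0\<^sub>v (n * s)) $ i" .
    qed (use Y in simp)
    moreover have "?J ^\<^sub>m Suc k *\<^sub>v v = 0\<^sub>v (n * s)" if "\<not> Suc k < s"
    proof -
      have "Suc k = s" using k that by simp
      then show ?thesis using J_mat_nilpotent[OF v] by metis
    qed
    ultimately show "col (?J * Y) k = col (Y * N) k" using col_Y by auto
  qed (use Y N J in auto)
  moreover obtain x where x: "x \<in> carrier_vec s" "u = Y *\<^sub>v x" using u krylov by auto
  ultimately have "?J *\<^sub>v u = Y *\<^sub>v (N *\<^sub>v x)"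
    using assoc_mult_mat_vec[OF J Y x(1)] assoc_mult_mat_vec[OF Y N x(1)] by simp
  then show ?thesis unfolding krylov using N x(1) by auto
qed

section \<open>Coordinates with respect to the columns of X\<close>

text \<open>The basis property speaks of the span inside the subspace. It agrees with the span in
  the ambient space, which is the column space of \<open>X\<close>.\<close>

lemma columns_form_basis_krylov:
  assumes v: "v \<in> carrier_vec m" and M: "M \<in> carrier_mat m m" and X: "X \<in> carrier_mat m s"
    and basis: "columns_form_basis m (krylov_space s M v) X"
  shows "krylov_space s M v = {X *\<^sub>v x | x. x \<in> carrier_vec s}"
proof -
  interpret vec_space "TYPE(complex)" m .
  let ?U = "krylov_space s M v" and ?S = "{M ^\<^sub>m k *\<^sub>v v | k. k < s}"
  have S: "?S \<subseteq> carrier_vec m" using mult_mat_vec_carrier[OF pow_carrier_mat[OF M] v] by auto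
  have U: "?U = span ?S" using v unfolding krylov_space_def by simp
  have sub: "submodule class_ring ?U V"
    unfolding U using span_is_submodule[of ?S] S by simp
  \<comment> \<open>The definition of a basis unfolds only for a structure known to be a vector
    space.\<close>
  then have "vectorspace class_ring (vs ?U)"
    unfolding vectorspace_def using submodule_is_module[OF sub] class_field by blast
  from basis[unfolded columns_form_basis_def vectorspace.basis_def[OF this]]
  have "set (cols X) \<subseteq> ?U"
    and "LinearCombinations.module.span class_ring (vs ?U) (set (cols X)) = ?U"
    by auto
  then have "?U = col_space X"
    using span_li_not_depend(1)[OF _ sub] unfolding col_space_def by simp
  also have "\<dots> = {X *\<^sub>v x | x. x \<in> carrier_vec s}"
    unfolding col_space_eq[OF X] using X by auto
  finally show ?thesis .
qed

text \<open>A nonzero kernel vector is a linear dependence of the columns. Distinctness lets the set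
  of columns stand for the family.\<close>

lemma full_rank_mult_vec_eq_0:
  fixes X :: "complex mat"
  assumes X: "X \<in> carrier_mat m s" and rank: "vec_space.rank m X = s" and dist: "distinct (cols X)"
    and z: "z \<in> carrier_vec s" and 0: "X *\<^sub>v z = 0\<^sub>v m"
  shows "z = 0\<^sub>v s"
proof -
  interpret vec_space "TYPE(complex)" m .
  show ?thesis
    using lin_depI[OF X z _ 0 dist] full_rank_lin_indpt[OF X rank dist] by blast
qed

text \<open>The columns of \<open>N\<close> are the coordinates of the columns of \<open>B\<close>,
  and injectivity of \<open>X\<close> makes them unique.\<close>

lemma ex1_right_factor:
  fixes X B :: "complex mat"
  assumes X: "X \<in> carrier_mat m s" and B: "B \<in> carrier_mat m s"
    and inj: "\<And>z. z \<in> carrier_vec s \<Longrightarrow> X *\<^sub>v z = 0\<^sub>v m \<Longrightarrow> z = 0\<^sub>v s"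
    and range: "\<And>j. j < s \<Longrightarrow> \<exists>x \<in> carrier_vec s. col B j = X *\<^sub>v x"
  shows "\<exists>!N. N \<in> carrier_mat s s \<and> B = X * N"
proof -
  obtain c where c: "\<And>j. j < s \<Longrightarrow> c j \<in> carrier_vec s" "\<And>j. j < s \<Longrightarrow> col B j = X *\<^sub>v c j"
    using range by metis
  let ?N = "mat_of_cols s (map c [0..<s])"
  have N: "?N \<in> carrier_mat s s" by (rule carrier_matI) simp_all
  have "B = X * ?N"
  proof (rule mat_col_eqI)
    fix j assume "j < dim_col (X * ?N)"
    then have j: "j < s" by simp
    show "col B j = col (X * ?N) j"
      using col_mult2[OF X N j] c[OF j] j by (simp add: col_mat_of_cols)
  qed (use X B in auto)
  moreover have "N = N'"
    if N: "N \<in> carrier_mat s s" "N' \<in> carrier_mat s s" and eq: "X * N = X * N'" for N N'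
  proof (rule mat_col_eqI)
    fix j assume "j < dim_col N'"
    then have j: "j < s" using N by simp
    have cols: "col N j \<in> carrier_vec s" "col N' j \<in> carrier_vec s" using N j by auto
    have "X *\<^sub>v col N j = X *\<^sub>v col N' j"
      using col_mult2[OF X N(1) j] col_mult2[OF X N(2) j] eq by simp
    then have "X *\<^sub>v (col N j - col N' j) = 0\<^sub>v m"
      using X cols by (simp add: mult_minus_distrib_mat_vec[OF X] minus_cancel_vec[of _ m])
    then have "col N j - col N' j = 0\<^sub>v s" using inj cols by auto
    then show "col N j = col N' j" using cols N by (auto simp: vec_eq_iff)
  qed (use N in auto)
  ultimately show ?thesis using N by metis
qed

text \<open>The range of \<open>X\<close> is the invariant Krylov space, so it contains every column
  of \<open>J_mat n s * X\<close>. Unique existence then justifies the definite description.\<close>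

lemma N_mat:
  assumes X: "X \<in> carrier_mat (n * s) s" and rank: "vec_space.rank (n * s) X = s"
    and basis: "columns_form_basis (n * s) (krylov_space s (J_mat n s) v) X"
    and v: "v \<in> carrier_vec (n * s)"
  shows "N_mat n s X \<in> carrier_mat s s" and "J_mat n s * X = X * N_mat n s X"
proof -
  let ?J = "J_mat n s" and ?U = "krylov_space s (J_mat n s) v"
  note J = J_mat_carrier[of n s]
  note U = columns_form_basis_krylov[OF v J X basis]
  have dist: "distinct (cols X)" using basis unfolding columns_form_basis_def by blast
  have "\<exists>x \<in> carrier_vec s. col (?J * X) j = X *\<^sub>v x" if j: "j < s" for j
  proof -
    \<comment> \<open>Column \<open>j\<close> of \<open>X\<close> is the image of a unit vector,
      hence lies in \<open>?U\<close>.\<close>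
    have "X *\<^sub>v unit_vec s j = col (X * 1\<^sub>m s) j"
      using col_mult2[OF X one_carrier_mat j] j by simp
    then have "col X j = X *\<^sub>v unit_vec s j" using X by simp
    then have "col X j \<in> ?U" unfolding U by auto
    then have "?J *\<^sub>v col X j \<in> ?U" by (rule krylov_space_J_mat_invariant[OF v])
    then show ?thesis using col_mult2[OF J X j] unfolding U by auto
  qed
  then have "\<exists>!N. N \<in> carrier_mat s s \<and> ?J * X = X * N"
    by (intro ex1_right_factor[OF X mult_carrier_mat[OF J X]] full_rank_mult_vec_eq_0[OF X rank dist])
  from theI'[OF this]
  show "N_mat n s X \<in> carrier_mat s s" "?J * X = X * N_mat n s X"
    unfolding N_mat_def by auto
qed

section \<open>The block matrices Q, K and W\<close>

lemma Q_mat_carrier: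
  "X \<in> carrier_mat (n * s) s \<Longrightarrow> Q_mat n s X \<in> carrier_mat (n + n * s) (n + s)"
  unfolding Q_mat_def by simp

text \<open>Splitting \<open>z\<close> into its first \<open>n\<close> and last \<open>s\<close>
  entries \<open>a\<close> and \<open>c\<close>, the product is \<open>a\<close> followed by
  \<open>X *\<^sub>v c\<close>.\<close>

lemma Q_mat_mult_vec_eq_0:
  assumes X: "X \<in> carrier_mat (n * s) s"
    and inj: "\<And>z. z \<in> carrier_vec s \<Longrightarrow> X *\<^sub>v z = 0\<^sub>v (n * s) \<Longrightarrow> z = 0\<^sub>v s"
    and z: "z \<in> carrier_vec (n + s)" and 0: "Q_mat n s X *\<^sub>v z = 0\<^sub>v (n + n * s)"
  shows "z = 0\<^sub>v (n + s)"
proof -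
  define a c where "a = vec_first z n" and "c = vec_last z s"
  have zac: "z = a @\<^sub>v c" and a: "a \<in> carrier_vec n" and c: "c \<in> carrier_vec s"
    unfolding a_def c_def using z by auto
  have "Q_mat n s X *\<^sub>v z = a @\<^sub>v (X *\<^sub>v c)"
    unfolding zac Q_mat_def
    by (subst four_block_mat_mult_vec[where ?nr1.0 = n and ?nc1.0 = n and ?nc2.0 = s and ?nr2.0 = "n * s"])
      (use a c X in auto)
  moreover have "0\<^sub>v (n + n * s) = 0\<^sub>v n @\<^sub>v (0\<^sub>v (n * s) :: complex vec)"
    by (rule eq_vecI) auto
  ultimately have eq: "a @\<^sub>v (X *\<^sub>v c) = 0\<^sub>v n @\<^sub>v 0\<^sub>v (n * s)" using 0 by simp
  have "a = 0\<^sub>v n" "X *\<^sub>v c = 0\<^sub>v (n * s)"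
    using eq append_vec_eq[OF a, of "0\<^sub>v n"] by auto
  then show ?thesis unfolding zac using inj[OF c] by auto
qed

text \<open>Both products have the blocks \<open>A\<close>, \<open>E X\<close> and zero; the lower
  right blocks are \<open>X N\<close> and \<open>J X\<close>, which agree.\<close>

lemma Q_mat_intertwines:
  assumes A: "A \<in> carrier_mat n n" and X: "X \<in> carrier_mat (n * s) s"
    and N: "N_mat n s X \<in> carrier_mat s s" "J_mat n s * X = X * N_mat n s X"
  shows "Q_mat n s X * K_mat n s A X = W_mat n s A * Q_mat n s X"
proof -
  have E: "E_mat n s \<in> carrier_mat n (n * s)" unfolding E_mat_def by simp
  note J = J_mat_carrier[of n s]
  have EX: "E_mat n s * X \<in> carrier_mat n s" using E X by auto
  have XN: "X * N_mat n s X \<in> carrier_mat (n * s) s" using X N(1) by auto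
  have JX: "J_mat n s * X \<in> carrier_mat (n * s) s" using J X by auto
  have "Q_mat n s X * K_mat n s A X =
      four_block_mat A (E_mat n s * X) (0\<^sub>m (n * s) n) (X * N_mat n s X)"
    unfolding Q_mat_def K_mat_def
      mult_four_block_mat[OF one_carrier_mat zero_carrier_mat zero_carrier_mat X A EX
        zero_carrier_mat N(1)]
    using A X N(1) by (intro cong_four_block_mat)
      (simp_all add: left_mult_one_mat[OF EX] right_add_zero_mat[OF EX] left_mult_zero_mat[OF EX]
        left_add_zero_mat[OF XN])
  also have "\<dots> = W_mat n s A * Q_mat n s X"
    unfolding Q_mat_def W_mat_def
      mult_four_block_mat[OF A E zero_carrier_mat J one_carrier_mat zero_carrier_mat
        zero_carrier_mat X] N(2)[symmetric]
    using A E J X by (intro cong_four_block_mat)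
      (simp_all add: left_add_zero_mat[OF EX] left_add_zero_mat[OF JX])
  finally show ?thesis .
qed

theorem lemma5p2:
  fixes n s :: nat and A X :: "complex mat" and b :: "nat \<Rightarrow> complex vec"
  assumes "n \<ge> 1" and "s \<ge> 1"
    and "A \<in> carrier_mat n n"
    and "\<And>i. i \<in> {1..s} \<Longrightarrow> b i \<in> carrier_vec n"
    and "b s \<noteq> 0\<^sub>v n"
    and "X \<in> carrier_mat (n * s) s"
    and "vec_space.rank (n * s) X = s"
    and "columns_form_basis (n * s) (krylov_space s (J_mat n s) (b_stack n s b)) X"
  shows "metric_field_of_values (M_mat n s X) (K_mat n s A X) =
           field_of_values (R_mat n s X * K_mat n s A X * matrix_inv (R_mat n s X)) \<and>
         metric_field_of_values (M_mat n s X) (K_mat n s A X) \<subseteq> field_of_values (W_mat n s A)"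
proof -
  note A = assms(3) and X = assms(6) and rank = assms(7) and basis = assms(8)
  have "b_stack n s b \<in> carrier_vec (n * s)" unfolding b_stack_def by simp
  note N = N_mat[OF X rank basis this]
  have dist: "distinct (cols X)" using basis unfolding columns_form_basis_def by blast
  note Q = Q_mat_carrier[OF X]
  note inj = Q_mat_mult_vec_eq_0[OF X full_rank_mult_vec_eq_0[OF X rank dist]]
  have K: "K_mat n s A X \<in> carrier_mat (n + s) (n + s)"
    unfolding K_mat_def using A N(1) by simp
  have W: "W_mat n s A \<in> carrier_mat (n + n * s) (n + n * s)"
    unfolding W_mat_def using A J_mat_carrier[of n s] by simp
  \<comment> \<open>Injectivity of \<open>Q_mat n s X\<close> makes its Gram matrix definite, so the
    principal square root exists.\<close>
  have M: "hermitian_pos_def (M_mat n s X)" "M_mat n s X \<in> carrier_mat (n + s) (n + s)"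
    unfolding M_mat_def
    by (rule hermitian_pos_def_gram[OF Q inj], assumption+)
      (rule mult_carrier_mat[OF mat_adjoint_carrier[OF Q] Q])
  note R = principal_sqrt[OF M, folded R_mat_def]
  show ?thesis
  proof
    show "metric_field_of_values (M_mat n s X) (K_mat n s A X) =
        field_of_values (R_mat n s X * K_mat n s A X * matrix_inv (R_mat n s X))"
      by (rule metric_field_of_values_conv_sqrt[OF R(2,1) K, unfolded R(3)])
    show "metric_field_of_values (M_mat n s X) (K_mat n s A X) \<subseteq> field_of_values (W_mat n s A)"
      unfolding M_mat_def
      by (rule metric_field_of_values_gram_subset[OF Q K W inj Q_mat_intertwines[OF A X N]])
  qed
qed

end
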